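(* Let $d=(d_1,\ldots,d_n)$ be a non-increasing sequence of positive integers such that $\sum_{i=1}^n d_i$ is an even number at most $2n-2$. If $n_1(d)\ge\sum_{i=1}^{n_{\ge2}(d)}d_i$, then $$\gamma^{\mathcal F}_{\min}(d)=s\ell(d)=n-a(d)=n_{\ge2}(d)+\frac{n_1(d)-\sum_{i=1}^{n_{\ge2}(d)}d_i}{2}.$$
   Context: All graphs are finite, simple and undirected. $[n]=\{1,\ldots,n\}$; empty sums are $0$. For a sequence $d$ of non-negative integers, $n_1(d)$ is the number of entries of $d$ equal to $1$, $n_{\ge2}(d)$ is the number of entries of $d$ that are at least $2$, and $\mathcal{F}(d)$ is the set of all forests with degree sequence $d$. A set $D$ of vertices of a graph $G$ is a dominating set if every vertex in $V(G)\setminus D$ has a neighbor in $D$; $\gamma(G)$ is the minimum order of a dominating set of $G$. $\gamma^{\mathcal F}_{\min}(d)=\min\{\gamma(F):F\in\mathcal{F}(d)\}$. (It is well known that a sequence $d$ as in the statement is the degree sequence of some forest, so this minimum exists.) For a non-increasing sequence $d=(d_1,\ldots,d_n)$, $$s\ell(d)=\min\Big\{k\in[n]:\sum_{i=1}^k d_i\ge n-k\Big\},\qquad a(d)=\max\Big\{a\in[n]:\sum_{i=n-a+1}^n d_i\le\sum_{i=1}^{n-a}d_i\Big\}.$$ *)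

theory Defs
  imports "Graph_Theory.Graph_Theory" "HOL-Library.Multiset" Complex_Main
begin

text \<open>
  A finite simple undirected graph is a \<^locale>\<open>pair_graph\<close>: a finite vertex set with a finite,
  symmetric, irreflexive arc set. An edge \<open>uv\<close> is the pair of arcs \<open>(u, v)\<close>, \<open>(v, u)\<close>, so
  the degree of a vertex is its out-degree.
\<close>

text \<open>
  In a symmetric digraph every edge yields the closed arc walk \<open>u, v, u\<close>, which
  \<^const>\<open>pre_digraph.cycle\<close> accepts. The cycles of the underlying undirected graph are those of
  length at least 3; for this reason the library constant \<^const>\<open>forest\<close> is not used here.
\<close>

definition undirected_forest :: "'a pair_pre_digraph \<Rightarrow> bool" where
  "undirected_forest G \<longleftrightarrow>
     pair_graph G \<and> \<not> (\<exists>p. pre_digraph.cycle (with_proj G) p \<and> 3 \<le> length p)"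

definition has_degree_sequence :: "'a pair_pre_digraph \<Rightarrow> nat list \<Rightarrow> bool" where
  "has_degree_sequence G d \<longleftrightarrow>
     image_mset (out_degree (with_proj G)) (mset_set (pverts G)) = mset d"

definition dominating_set :: "'a pair_pre_digraph \<Rightarrow> 'a set \<Rightarrow> bool" where
  "dominating_set G D \<longleftrightarrow>
     D \<subseteq> pverts G \<and> (\<forall>v \<in> pverts G - D. \<exists>u \<in> D. (v, u) \<in> parcs G)"

definition domination_number :: "'a pair_pre_digraph \<Rightarrow> nat" where
  "domination_number G = Min (card ` {D. dominating_set G D})"

text \<open>
  Every finite graph has an isomorphic copy with vertices in \<^typ>\<open>nat\<close>, so restricting the vertex
  type loses no isomorphism class. The vertex set is an arbitrary finite set of naturals.
\<close>

definition forests_with_degrees :: "nat list \<Rightarrow> nat pair_pre_digraph set" where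
  "forests_with_degrees d = {F. undirected_forest F \<and> has_degree_sequence F d}"

definition gamma_forest_min :: "nat list \<Rightarrow> nat" where
  "gamma_forest_min d = Min (domination_number ` forests_with_degrees d)"

definition n_one :: "nat list \<Rightarrow> nat" where
  "n_one d = length (filter (\<lambda>x. x = 1) d)"

definition n_ge_two :: "nat list \<Rightarrow> nat" where
  "n_ge_two d = length (filter (\<lambda>x. 2 \<le> x) d)"

text \<open>
  For a list \<open>d\<close> of length \<open>n\<close>, the sum of \<open>d\<^sub>1, \<dots>, d\<^sub>k\<close> is
  \<^term>\<open>sum_list (take k d)\<close> and the sum of the last \<open>a\<close> entries is
  \<^term>\<open>sum_list (drop (length d - a) d)\<close>. All natural-number subtractions below are
  subtractions of some \<open>k \<le> n\<close> from \<open>n\<close>.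
\<close>

definition slater :: "nat list \<Rightarrow> nat" where
  "slater d = Min {k \<in> {1..length d}. length d - k \<le> sum_list (take k d)}"

definition annihilation :: "nat list \<Rightarrow> nat" where
  "annihilation d = Max {a \<in> {1..length d}.
     sum_list (drop (length d - a) d) \<le> sum_list (take (length d - a) d)}"

end

theory Submission
  imports Defs
begin

text \<open>
  A dominating set \<open>D\<close> of \<open>k\<close> vertices in a graph on \<open>n\<close> vertices satisfies
  \<open>n - k \<le> \<Sum>\<^sub>u\<^sub>\<in>\<^sub>D deg u \<le> d\<^sub>1 + \<dots> + d\<^sub>k\<close>, so \<open>k\<close> is at least the Slater number. Under the
  hypothesis of the theorem, all entries beyond position \<open>n\<^sub>\<ge>\<^sub>2(d)\<close> are \<open>1\<close>, and for
  \<open>k = n\<^sub>\<ge>\<^sub>2(d) + (n\<^sub>1(d) - \<Sum>d\<^sub>i) / 2\<close> the first \<open>k\<close> entries sum to exactly \<open>n - k\<close>. Strict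
  monotonicity of prefix sums then yields the values of \<open>s\<ell>(d)\<close> and \<open>n - a(d)\<close>, and the disjoint
  union of \<open>k\<close> stars with \<open>d\<^sub>1, \<dots>, d\<^sub>k\<close> leaves is a forest dominated by its \<open>k\<close> centers.
\<close>

section \<open>Prefix sums\<close>

lemma sum_list_take_strict_mono:
  fixes d :: "nat list"
  assumes pos: "\<forall>x \<in> set d. 0 < x" and "i < j" "j \<le> length d"
  shows "sum_list (take i d) < sum_list (take j d)"
proof -
  obtain l where j: "j = i + Suc l" using less_imp_Suc_add[OF \<open>i < j\<close>] by auto
  have *: "take j d = take i d @ take (Suc l) (drop i d)" by (simp only: j take_add)
  have "i < length d" using assms by simp
  then have "drop i d = d ! i # drop (Suc i) d" by (simp add: Cons_nth_drop_Suc)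
  moreover have "0 < d ! i" using pos \<open>i < length d\<close> by simp
  ultimately show ?thesis unfolding * by simp
qed

text \<open>Exchange argument along \<open>d\<close>: an element of \<open>M\<close> that is at most
  the head of \<open>d\<close> can be removed so that the rest of \<open>M\<close> still fits into
  the tail.\<close>

lemma sum_mset_le_sum_list_take:
  fixes d :: "nat list"
  assumes "sorted_wrt (\<ge>) d" "M \<subseteq># mset d"
  shows "sum_mset M \<le> sum_list (take (size M) d)"
  using assms
proof (induction d arbitrary: M)
  case (Cons x ds)
  show ?case
  proof (cases "M = {#}")
    case False
    \<comment> \<open>Take \<open>y = x\<close> if \<open>x\<close> occurs in \<open>M\<close>.
      Otherwise \<open>M\<close> already lies in \<open>mset ds\<close>, and sortedness makes any
      element of \<open>M\<close> suitable.\<close>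
    obtain y where y: "y \<in># M" "y \<le> x" "M - {#y#} \<subseteq># mset ds"
    proof (cases "x \<in># M")
      case True
      then show ?thesis using Cons.prems that[of x] by (simp add: subset_eq_diff_conv)
    next
      case nx: False
      obtain y where y: "y \<in># M" using False by auto
      have "M \<subseteq># mset ds"
        using Cons.prems(2) nx by (simp add: inter_add_right1 subset_mset.inf.absorb_iff1)
      moreover from this y have "y \<in> set ds" by (metis mset_subset_eqD set_mset_mset)
      ultimately show ?thesis using that[of y] y Cons.prems(1)
        by (auto intro: subset_mset.order_trans[OF diff_subset_eq_self])
    qed
    then obtain N where N: "M = add_mset y N" by (meson mset_add)
    then have "sum_mset N \<le> sum_list (take (size N) ds)"
      using Cons.IH[of N] Cons.prems(1) y(3) by simp
    then show ?thesis using N y(2) by simp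
  qed simp
qed simp

lemma sorted_positive_split:
  assumes "sorted_wrt (\<ge>) d" "\<forall>x \<in> set d. 0 < x"
  shows "d = filter (\<lambda>x. 2 \<le> x) d @ replicate (n_one d) 1"
  using assms
proof (induction d)
  case (Cons x d)
  show ?case
  proof (cases "2 \<le> x")
    case True
    have "d = filter (\<lambda>x. 2 \<le> x) d @ replicate (n_one d) 1" by (rule Cons.IH) (use Cons.prems in auto)
    moreover have "n_one (x # d) = n_one d" using True by (simp add: n_one_def)
    ultimately show ?thesis using True by (metis append_Cons filter.simps(2))
  next
    case False
    with Cons.prems have x: "x = 1" and d: "\<forall>y \<in> set d. y = 1" by force+
    then have "filter (\<lambda>x. 2 \<le> x) d = []" "filter (\<lambda>x. x = 1) d = d"
      by (auto simp: filter_empty_conv filter_id_conv)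
    then show ?thesis using d x by (simp add: n_one_def replicate_length_same)
  qed
qed (simp add: n_one_def)

lemma drop_n_ge_two:
  assumes "sorted_wrt (\<ge>) d" "\<forall>x \<in> set d. 0 < x"
  shows "drop (n_ge_two d) d = replicate (n_one d) 1"
  by (subst (2) sorted_positive_split[OF assms]) (simp add: n_ge_two_def)

section \<open>Domination\<close>

lemma finite_dominating_sets: "finite (pverts G) \<Longrightarrow> finite {D. dominating_set G D}"
  by (rule finite_subset[of _ "Pow (pverts G)"]) (auto simp: dominating_set_def)

lemma dominating_set_pverts: "dominating_set G (pverts G)"
  by (simp add: dominating_set_def)

lemma domination_number_le:
  "finite (pverts G) \<Longrightarrow> dominating_set G D \<Longrightarrow> domination_number G \<le> card D"
  unfolding domination_number_def by (auto intro!: Min_le finite_dominating_sets)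

lemma domination_number_attained:
  assumes "finite (pverts G)"
  obtains D where "dominating_set G D" "card D = domination_number G"
proof -
  have "domination_number G \<in> card ` {D. dominating_set G D}"
    unfolding domination_number_def
    by (rule Min_in) (use finite_dominating_sets[OF assms] dominating_set_pverts in auto)
  then show thesis using that by auto
qed

text \<open>The set \<open>D\<close> and the neighborhoods of its members cover all vertices, so the
  union bound applies.\<close>

lemma dominating_set_degree_sum:
  assumes "pair_graph G" "dominating_set G D"
  shows "card (pverts G) \<le> card D + (\<Sum>u\<in>D. out_degree (with_proj G) u)"
proof -
  interpret pair_graph G by fact
  let ?N = "\<lambda>u. snd ` out_arcs (with_proj G) u"
  have D: "D \<subseteq> pverts G" "finite D"
    using assms(2) finite_verts by (auto simp: dominating_set_def intro: finite_subset)
  have "pverts G \<subseteq> D \<union> (\<Union>u\<in>D. ?N u)"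
  proof
    fix v assume v: "v \<in> pverts G"
    show "v \<in> D \<union> (\<Union>u\<in>D. ?N u)"
    proof (cases "v \<in> D")
      case False
      with v assms(2) obtain u where u: "u \<in> D" "(v, u) \<in> parcs G"
        by (auto simp: dominating_set_def)
      then have "(u, v) \<in> parcs G" using arcs_symmetric by simp
      then show ?thesis using u by (force simp: out_arcs_def)
    qed simp
  qed
  moreover have fin: "finite (?N u)" for u by (simp add: out_arcs_def)
  ultimately have "card (pverts G) \<le> card (D \<union> (\<Union>u\<in>D. ?N u))"
    using D by (intro card_mono) auto
  also have "\<dots> \<le> card D + card (\<Union>u\<in>D. ?N u)" by (rule card_Un_le)
  also have "card (\<Union>u\<in>D. ?N u) \<le> (\<Sum>u\<in>D. card (?N u))" using D by (intro card_UN_le)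
  also have "\<dots> \<le> (\<Sum>u\<in>D. out_degree (with_proj G) u)"
    unfolding out_degree_def by (intro sum_mono card_image_le) (simp add: out_arcs_def)
  finally show ?thesis by simp
qed

lemma has_degree_sequence_card: "has_degree_sequence G d \<Longrightarrow> card (pverts G) = length d"
  by (metis has_degree_sequence_def size_image_mset size_mset size_mset_set)

text \<open>The degrees in a minimum dominating set \<open>D\<close> form a submultiset of
  \<open>d\<close>, so their sum is at most that of the \<open>card D\<close> largest entries. Hence
  \<open>card D\<close> is a candidate in the minimum defining \<open>slater d\<close>.\<close>

lemma slater_le_domination_number:
  assumes "sorted_wrt (\<ge>) d" "d \<noteq> []" "pair_graph G" "has_degree_sequence G d"
  shows "slater d \<le> domination_number G"
proof -
  interpret pair_graph G by fact
  obtain D where D: "dominating_set G D" "card D = domination_number G"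
    using domination_number_attained finite_verts by blast
  have DV: "D \<subseteq> pverts G" using D by (simp add: dominating_set_def)
  then have fin: "finite D" using finite_verts finite_subset by blast
  let ?M = "image_mset (out_degree (with_proj G)) (mset_set D)"
  have "?M \<subseteq># mset d"
    using assms(4) DV finite_verts fin unfolding has_degree_sequence_def
    by (metis image_mset_subseteq_mono subset_imp_msubset_mset_set)
  from sum_mset_le_sum_list_take[OF assms(1) this]
  have le: "(\<Sum>u\<in>D. out_degree (with_proj G) u) \<le> sum_list (take (card D) d)"
    by (simp add: sum_unfold_sum_mset)
  have n: "card (pverts G) = length d" using has_degree_sequence_card assms(4) .
  have "length d \<le> card D + sum_list (take (card D) d)"
    using dominating_set_degree_sum[OF assms(3) D(1)] le n by simp
  \<comment> \<open>The candidates for \<open>slater d\<close> start at 1, so an empty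
    \<open>D\<close> has to be excluded.\<close>
  moreover from this have "card D \<noteq> 0" using assms(2) by (intro notI) simp
  moreover have "card D \<le> length d" using card_mono[OF finite_verts] DV n by simp
  ultimately show ?thesis unfolding slater_def D(2)[symmetric]
    by (intro Min_le) auto
qed

section \<open>Disjoint unions of stars\<close>

text \<open>The map \<open>c\<close> sends each leaf to its center, so the degree of a center is the
  size of a fibre of \<open>c\<close>; an empty fibre gives an isolated center.\<close>

definition star_forest :: "'a set \<Rightarrow> 'a set \<Rightarrow> ('a \<Rightarrow> 'a) \<Rightarrow> 'a pair_pre_digraph" where
  "star_forest C L c =
     \<lparr> pverts = C \<union> L, parcs = (\<lambda>v. (v, c v)) ` L \<union> (\<lambda>v. (c v, v)) ` L \<rparr>"

locale star_partition =
  fixes C L :: "'a set" and c :: "'a \<Rightarrow> 'a"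
  assumes finite_C: "finite C" and finite_L: "finite L"
    and disjoint: "C \<inter> L = {}" and center: "\<And>v. v \<in> L \<Longrightarrow> c v \<in> C"
begin

lemma center_not_leaf: "v \<in> L \<Longrightarrow> c v \<notin> L"
  using center disjoint by blast

lemma star_arc_cases:
  assumes "(u, v) \<in> parcs (star_forest C L c)"
  obtains "u \<in> L" "v \<in> C" "v = c u" | "v \<in> L" "u \<in> C" "u = c v"
  using assms center by (auto simp: star_forest_def)

lemma pair_graph_star_forest: "pair_graph (star_forest C L c)"
proof -
  have "c v \<noteq> v" "v \<noteq> c v" if "v \<in> L" for v
    using center_not_leaf[OF that] that by auto
  then show ?thesis using finite_C finite_L center
    by unfold_locales (auto simp: star_forest_def symmetric_def intro!: symI)
qed

text \<open>
  Of two consecutive inner vertices of a walk one is a leaf, and the walk returns from a leaf to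
  the center it came from; so a closed walk of length at least 3 repeats a vertex.
\<close>

lemma undirected_forest_star_forest: "undirected_forest (star_forest C L c)"
  unfolding undirected_forest_def
proof (intro conjI notI)
  let ?G = "star_forest C L c"
  show "pair_graph ?G" by (rule pair_graph_star_forest)
  assume "\<exists>p. pre_digraph.cycle (with_proj ?G) p \<and> 3 \<le> length p"
  then obtain p a where p: "pre_digraph.awalk (with_proj ?G) a p a" "3 \<le> length p"
    and dist: "distinct (tl (pre_digraph.awalk_verts (with_proj ?G) a p))"
    by (auto simp: pre_digraph.cycle_def)
  obtain e f g q where "p = e # f # g # q"
    using p(2) by (auto simp: numeral_3_eq_3 Suc_le_length_iff)
  moreover obtain u v where "e = (u, v)" by fastforce
  moreover obtain w x where "f = (w, x)" by fastforce
  moreover obtain y z where "g = (y, z)" by fastforce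
  ultimately have p_eq: "p = (a, v) # (v, x) # (x, z) # q"
    and arcs: "(a, v) \<in> parcs ?G" "(v, x) \<in> parcs ?G" "(x, z) \<in> parcs ?G"
    and q: "pcas z q a"
    using p(1) by (auto simp: pre_digraph.awalk_def cas_with_proj_eq)
  have last_vertex: "pcas s r t \<Longrightarrow> t \<in> set (pawalk_verts s r)"
    for s :: 'a and r t
    by (induction r arbitrary: s) auto
  \<comment> \<open>The closed walk visits \<open>a\<close>, \<open>v\<close>, \<open>x\<close>,
    \<open>z\<close> and returns to \<open>a\<close>. Its vertices after the first are distinct and
    include \<open>a\<close> and \<open>z\<close> from the third step on, which separates
    \<open>x\<close> from \<open>a\<close> and \<open>v\<close> from \<open>z\<close>.\<close>
  have "a \<in> set (pawalk_verts z q)" by (rule last_vertex[OF q])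
  moreover have "z \<in> set (pawalk_verts z q)" using q by (cases q) auto
  moreover have "distinct (v # x # pawalk_verts z q)"
    using dist by (simp add: p_eq awalk_verts_with_proj_eq)
  ultimately have "x \<noteq> a" "v \<noteq> z" by auto
  \<comment> \<open>If \<open>v\<close> is a leaf, then \<open>a\<close> and \<open>x\<close> are
    both \<open>c v\<close>; if \<open>x\<close> is a leaf, then \<open>v\<close> and
    \<open>z\<close> are both \<open>c x\<close>.\<close>
  moreover have "x = a \<or> v = z"
    using arcs disjoint by (elim star_arc_cases) auto
  ultimately show False by blast
qed

lemma out_degree_leaf:
  assumes "v \<in> L"
  shows "out_degree (with_proj (star_forest C L c)) v = 1"
proof -
  have "out_arcs (with_proj (star_forest C L c)) v = {(v, c v)}"
    using assms center_not_leaf by (auto simp: out_arcs_def star_forest_def)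
  then show ?thesis by (simp add: out_degree_def)
qed

lemma out_degree_center:
  assumes "u \<in> C"
  shows "out_degree (with_proj (star_forest C L c)) u = card {v \<in> L. c v = u}"
proof -
  have "out_arcs (with_proj (star_forest C L c)) u = Pair u ` {v \<in> L. c v = u}"
    using assms disjoint center by (auto simp: out_arcs_def star_forest_def)
  then show ?thesis by (simp add: out_degree_def card_image inj_on_def)
qed

lemma dominating_set_centers: "dominating_set (star_forest C L c) C"
  using center by (auto simp: dominating_set_def star_forest_def)

end

text \<open>Distributes leaves among centers with prescribed star sizes. By induction on
  \<open>k\<close>, any \<open>f k\<close> elements form the last fibre and the rest is split
  recursively.\<close>

lemma exists_fibres_of_card:
  fixes f :: "nat \<Rightarrow> nat"
  assumes "finite L" "card L = (\<Sum>i<k. f i)"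
  shows "\<exists>c. (\<forall>v\<in>L. c v < k) \<and> (\<forall>i<k. card {v \<in> L. c v = i} = f i)"
  using assms
proof (induction k arbitrary: L)
  case (Suc k)
  from Suc.prems obtain A where A: "A \<subseteq> L" "card A = f k"
    using obtain_subset_with_card_n[of "f k" L] by auto
  then have "card (L - A) = (\<Sum>i<k. f i)"
    using Suc.prems by (simp add: card_Diff_subset finite_subset)
  with Suc.IH[of "L - A"] Suc.prems(1) obtain c
    where c: "\<forall>v\<in>L - A. c v < k" "\<forall>i<k. card {v \<in> L - A. c v = i} = f i" by auto
  let ?c = "\<lambda>v. if v \<in> A then k else c v"
  have "{v \<in> L. ?c v = i} = {v \<in> L - A. c v = i}" if "i < k" for i using that by auto
  moreover have "{v \<in> L. ?c v = k} = A" using A(1) c(1) by auto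
  ultimately have "\<forall>i<Suc k. card {v \<in> L. ?c v = i} = f i"
    using c(2) A(2) by (simp add: less_Suc_eq)
  moreover have "\<forall>v\<in>L. ?c v < Suc k" using c(1) by (auto simp: less_Suc_eq)
  ultimately show ?case by (intro exI[of _ ?c] conjI)
qed simp

text \<open>The vertices are the positions in \<open>d\<close>: the first \<open>k\<close> are
  centers, the others leaves. The sum condition says that the centers need exactly as many leaves as
  there are.\<close>

lemma exists_star_forest:
  assumes "k \<le> length d" "sum_list (take k d) = length d - k" "\<forall>x \<in> set (drop k d). x = 1"
  shows "\<exists>F \<in> forests_with_degrees d. domination_number F \<le> k"
proof -
  let ?n = "length d"
  have "(\<Sum>i<k. d ! i) = card {k..<?n}"
    using assms(1,2) by (simp add: sum_list_sum_nth atLeast0LessThan min_absorb2)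
  then obtain c where c: "\<forall>v\<in>{k..<?n}. c v < k"
      "\<forall>i<k. card {v \<in> {k..<?n}. c v = i} = d ! i"
    using exists_fibres_of_card[of "{k..<?n}" "(!) d" k] by auto
  interpret star_partition "{..<k}" "{k..<?n}" c
    using c(1) by unfold_locales auto
  let ?F = "star_forest {..<k} {k..<?n} c"
  have V: "pverts ?F = {0..<?n}" using assms(1) by (auto simp: star_forest_def)
  have "out_degree (with_proj ?F) v = d ! v" if "v < ?n" for v
  proof (cases "v < k")
    case True
    then show ?thesis using out_degree_center[of v] c(2) by simp
  next
    case False
    then have "d ! v \<in> set (drop k d)"
      using that by (auto simp: in_set_conv_nth intro!: exI[of _ "v - k"])
    then show ?thesis using out_degree_leaf[of v] False that assms(3) by simp
  qed
  then have "map (out_degree (with_proj ?F)) [0..<?n] = d"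
    by (intro nth_equalityI) auto
  then have "has_degree_sequence ?F d"
    unfolding has_degree_sequence_def V by (metis mset_map mset_upt)
  then have "?F \<in> forests_with_degrees d"
    using undirected_forest_star_forest by (simp add: forests_with_degrees_def)
  moreover have "domination_number ?F \<le> k"
    using domination_number_le[OF _ dominating_set_centers] V by simp
  ultimately show ?thesis by blast
qed

text \<open>The set of forests may be infinite, since their vertices are arbitrary naturals, but
  each domination number is at most the number of vertices.\<close>

lemma finite_domination_numbers: "finite (domination_number ` forests_with_degrees d)"
proof (rule finite_subset)
  show "domination_number ` forests_with_degrees d \<subseteq> {..length d}"
  proof clarsimp
    fix F assume F: "F \<in> forests_with_degrees d"
    then interpret pair_graph F
      by (simp add: forests_with_degrees_def undirected_forest_def)
    show "domination_number F \<le> length d"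
      using domination_number_le[OF finite_verts dominating_set_pverts] F has_degree_sequence_card[of F d]
      by (simp add: forests_with_degrees_def)
  qed
qed simp

section \<open>The exact value\<close>

text \<open>Going from \<open>k\<close> down to a smaller \<open>j\<close> shrinks the prefix sum
  and raises the bound \<open>length d - j\<close>, so equality at \<open>k\<close> rules out
  \<open>j\<close>.\<close>

lemma slater_eqI:
  assumes pos: "\<forall>x \<in> set d. 0 < x" and k: "1 \<le> k" "k \<le> length d"
    and eq: "sum_list (take k d) = length d - k"
  shows "slater d = k"
  unfolding slater_def
proof (rule Min_eqI)
  fix j assume j: "j \<in> {k \<in> {1..length d}. length d - k \<le> sum_list (take k d)}"
  show "k \<le> j"
  proof (rule ccontr)
    assume "\<not> k \<le> j"
    then have "sum_list (take j d) < sum_list (take k d)"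
      using sum_list_take_strict_mono[OF pos, of j k] k by simp
    moreover have "length d - j \<le> sum_list (take j d)" using j by simp
    ultimately show False using eq k \<open>\<not> k \<le> j\<close> by linarith
  qed
qed (use k eq in auto)

text \<open>The prefix of length \<open>k\<close> holds exactly half of the total. A larger tail
  leaves a shorter prefix with less than half, and \<open>k < length d\<close> keeps the tail length
  in the admissible range.\<close>

lemma annihilation_eqI:
  assumes pos: "\<forall>x \<in> set d. 0 < x" and k: "k < length d"
    and eq: "sum_list d = 2 * sum_list (take k d)"
  shows "annihilation d = length d - k"
proof -
  have tail: "sum_list (drop j d) = sum_list d - sum_list (take j d)" for j
    by (metis append_take_drop_id sum_list_append diff_add_inverse)
  show ?thesis unfolding annihilation_def
  proof (rule Max_eqI)
    fix a
    assume a: "a \<in> {a \<in> {1..length d}.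
      sum_list (drop (length d - a) d) \<le> sum_list (take (length d - a) d)}"
    show "a \<le> length d - k"
    proof (rule ccontr)
      assume "\<not> a \<le> length d - k"
      then have "length d - a < k" using a k by auto
      then have "sum_list (take (length d - a) d) < sum_list (take k d)"
        using sum_list_take_strict_mono[OF pos, of "length d - a" k] k by simp
      moreover have "sum_list (drop (length d - a) d) \<le> sum_list (take (length d - a) d)"
        using a by simp
      ultimately show False using eq tail[of "length d - a"] by linarith
    qed
  qed (use k eq tail[of k] in auto)
qed

text \<open>The Slater bound holds for every forest with degrees \<open>d\<close>, and a star forest
  attains it.\<close>

lemma gamma_forest_min_eqI:
  assumes "sorted_wrt (\<ge>) d" and pos: "\<forall>x \<in> set d. 0 < x"
    and k: "1 \<le> k" "k \<le> length d" and eq: "sum_list (take k d) = length d - k"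
    and ones: "\<forall>x \<in> set (drop k d). x = 1"
  shows "gamma_forest_min d = k"
  unfolding gamma_forest_min_def
proof (rule Min_eqI)
  show "finite (domination_number ` forests_with_degrees d)"
    by (rule finite_domination_numbers)
  have lower: "k \<le> domination_number F" if "F \<in> forests_with_degrees d" for F
    using slater_le_domination_number[OF assms(1) _ _, of F] that slater_eqI[OF pos k eq] k
    by (cases "d = []") (auto simp: forests_with_degrees_def undirected_forest_def)
  then show "\<And>y. y \<in> domination_number ` forests_with_degrees d \<Longrightarrow> k \<le> y" by auto
  obtain F where "F \<in> forests_with_degrees d" "domination_number F \<le> k"
    using exists_star_forest[OF k(2) eq ones] by blast
  with lower show "k \<in> domination_number ` forests_with_degrees d"
    by (metis imageI le_antisym)
qed

theorem proposition7:
  fixes d :: "nat list" and n :: nat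
  assumes "n = length d"
    and "sorted_wrt (\<ge>) d"
    and "\<forall>x \<in> set d. 0 < x"
    and "even (sum_list d)"
    and "int (sum_list d) \<le> 2 * int n - 2"
    and "sum_list (take (n_ge_two d) d) \<le> n_one d"
  shows "gamma_forest_min d = slater d
    \<and> real (slater d) = real n - real (annihilation d)
    \<and> real n - real (annihilation d)
        = real (n_ge_two d) + (real (n_one d) - real (sum_list (take (n_ge_two d) d))) / 2"
proof -
  define m where "m = n_ge_two d"
  define S where "S = sum_list (take m d)"
  define r where "r = n_one d"
  have drop_m: "drop m d = replicate r 1"
    using drop_n_ge_two[OF assms(2,3)] by (simp add: m_def r_def)
  have m: "m \<le> length d" by (simp add: m_def n_ge_two_def)
  then have n: "n = m + r" using arg_cong[OF drop_m, of length] assms(1) by simp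
  have "sum_list d = sum_list (take m d) + sum_list (drop m d)"
    by (metis append_take_drop_id sum_list_append)
  then have total: "sum_list d = S + r"
    by (simp add: S_def drop_m sum_list_replicate)
  \<comment> \<open>The total is \<open>S + r\<close>, which has the parity of
    \<open>r - S\<close>.\<close>
  have "even (r - S)" using assms(4,6) total by (simp add: S_def r_def m_def)
  then obtain t where "r - S = 2 * t" by (rule evenE)
  then have r: "r = S + 2 * t" using assms(6) by (simp add: S_def r_def m_def)
  \<comment> \<open>The \<open>m\<close> large entries take \<open>S\<close> of the ones as leaves.
    The remaining \<open>2 * t\<close> ones pair up into \<open>t\<close> single edges, each
    contributing one more center.\<close>
  define k where "k = m + t"
  have "take k d = take m d @ replicate t 1"
    by (simp add: k_def take_add drop_m r min_def)
  then have Sk: "sum_list (take k d) = S + t" by (simp add: S_def sum_list_replicate)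
  have "n \<noteq> 0" using assms(5) by linarith
  \<comment> \<open>Since \<open>n - k = S + t\<close>, the value \<open>k = 0\<close> means
    \<open>m = t = 0\<close> and \<open>k = n\<close> means \<open>S = t = 0\<close>. As
    \<open>m\<close> and \<open>S\<close> vanish together, either would give
    \<open>n = 0\<close>.\<close>
  have "m = 0 \<and> S = 0 \<or> 0 < m \<and> 0 < S"
    using sum_list_take_strict_mono[OF assms(3), of 0 m] m by (cases m) (simp_all add: S_def)
  then have k: "1 \<le> k" "k < length d"
    using \<open>n \<noteq> 0\<close> n r assms(1) by (auto simp: k_def)
  have eq: "sum_list (take k d) = length d - k"
    using Sk n r assms(1) by (simp add: k_def)
  have "drop k d = drop t (drop m d)" by (simp add: k_def add.commute)
  then have ones: "\<forall>x \<in> set (drop k d). x = 1" by (simp add: drop_m)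
  have "gamma_forest_min d = k" "slater d = k"
    using gamma_forest_min_eqI[OF assms(2,3) k(1) _ eq ones] slater_eqI[OF assms(3) k(1) _ eq] k
    by auto
  moreover have "annihilation d = n - k"
    using annihilation_eqI[OF assms(3) k(2)] Sk total r assms(1) by simp
  moreover have "real k = real (n_ge_two d)
      + (real (n_one d) - real (sum_list (take (n_ge_two d) d))) / 2"
    using r by (simp add: k_def flip: m_def r_def S_def)
  ultimately show ?thesis using k assms(1) by (simp add: of_nat_diff)
qed

end
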